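(* Let $n\ge 2$ and let $s,y\in\mathbb{R}^n$ satisfy $s^\top y>0$. For $t>0$ put $$\sigma^{\pm}(t)=\sqrt{\frac{t^2\|s\|^4+2t(s^\top y)\|s\|^2+\|s\|^2\|y\|^2}{4(s^\top y)^2}}\ \pm\ \sqrt{\frac{t^2\|s\|^4-2t(s^\top y)\|s\|^2+\|s\|^2\|y\|^2}{4(s^\top y)^2}},$$ and let $\mathrm{GM}(t),\mathrm{AM}(t),\mathrm{QM}(t)$ be the geometric, arithmetic and quadratic means of the two positive numbers $\sigma^-(t),\sigma^+(t)$. Then $$t^\star:=\frac{s^\top y}{\|s\|^2}$$ is the minimizer over $t>0$ of each of the four functions $$\sigma^+(t)-\sigma^-(t),\quad \mathrm{AM}(t)^2-\mathrm{GM}(t)^2,\quad \mathrm{QM}(t)^2-\mathrm{AM}(t)^2,\quad \mathrm{QM}(t)^2-\mathrm{GM}(t)^2.$$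
   Context: $\|\cdot\|$ is the Euclidean norm. For positive numbers $a_1,a_2$: $\mathrm{GM}=\sqrt{a_1a_2}$, $\mathrm{AM}=(a_1+a_2)/2$, $\mathrm{QM}=\sqrt{(a_1^2+a_2^2)/2}$. Here $s=x_{k+1}-x_k$ and $y=\nabla f(x_{k+1})-\nabla f(x_k)$ are the step and gradient displacement of a Dai--Liao conjugate gradient iteration; the Wolfe line search guarantees $s^\top y>0$. The numbers $\sigma^\pm(t)$ are the two generally non-unit singular values (the other $n-2$ being $1$) of the Dai--Liao search direction matrix $I-\frac{sy^\top}{s^\top y}+t\frac{ss^\top}{s^\top y}$. *)

theory Defs
  imports "HOL-Analysis.Analysis"
begin

definition sigma_plus :: "real ^ 'n \<Rightarrow> real ^ 'n \<Rightarrow> real \<Rightarrow> real" where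
  "sigma_plus s y t =
     sqrt ((t^2 * norm s ^ 4 + 2 * t * (s \<bullet> y) * norm s ^ 2 + norm s ^ 2 * norm y ^ 2) / (4 * (s \<bullet> y)^2))
   + sqrt ((t^2 * norm s ^ 4 - 2 * t * (s \<bullet> y) * norm s ^ 2 + norm s ^ 2 * norm y ^ 2) / (4 * (s \<bullet> y)^2))"

definition sigma_minus :: "real ^ 'n \<Rightarrow> real ^ 'n \<Rightarrow> real \<Rightarrow> real" where
  "sigma_minus s y t =
     sqrt ((t^2 * norm s ^ 4 + 2 * t * (s \<bullet> y) * norm s ^ 2 + norm s ^ 2 * norm y ^ 2) / (4 * (s \<bullet> y)^2))
   - sqrt ((t^2 * norm s ^ 4 - 2 * t * (s \<bullet> y) * norm s ^ 2 + norm s ^ 2 * norm y ^ 2) / (4 * (s \<bullet> y)^2))"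

definition GM :: "real \<Rightarrow> real \<Rightarrow> real" where
  "GM a b = sqrt (a * b)"

definition AM :: "real \<Rightarrow> real \<Rightarrow> real" where
  "AM a b = (a + b) / 2"

definition QM :: "real \<Rightarrow> real \<Rightarrow> real" where
  "QM a b = sqrt ((a^2 + b^2) / 2)"

definition the_minimizer_on :: "'a set \<Rightarrow> ('a \<Rightarrow> real) \<Rightarrow> 'a \<Rightarrow> bool" where
  "the_minimizer_on A f x \<longleftrightarrow>
     is_arg_min f (\<lambda>z. z \<in> A) x \<and> (\<forall>z. is_arg_min f (\<lambda>z. z \<in> A) z \<longrightarrow> z = x)"

end

theory Submission
  imports Defs
begin

text \<open>
  Write \<open>\<sigma>\<^sup>\<plusminus> = u \<plusminus> v\<close> with \<open>u > v \<ge> 0\<close>. Then \<open>AM\<^sup>2 = u\<^sup>2\<close>, \<open>GM\<^sup>2 = u\<^sup>2 - v\<^sup>2\<close> and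
  \<open>QM\<^sup>2 = u\<^sup>2 + v\<^sup>2\<close>, so the four functions are \<open>2v\<close>, \<open>v\<^sup>2\<close>, \<open>v\<^sup>2\<close> and \<open>2v\<^sup>2\<close>. Completing the
  square, \<open>4 (s \<bullet> y)\<^sup>2 v\<^sup>2 = (t \<parallel>s\<parallel>\<^sup>2 - s \<bullet> y)\<^sup>2 + (\<parallel>s\<parallel>\<^sup>2 \<parallel>y\<parallel>\<^sup>2 - (s \<bullet> y)\<^sup>2)\<close>, and the last term is
  nonnegative by Cauchy-Schwarz.
\<close>

text \<open>A strict inequality against every other point yields minimality and uniqueness at
  once.\<close>

lemma the_minimizer_onI:
  assumes "x \<in> A" "\<And>z. z \<in> A \<Longrightarrow> z \<noteq> x \<Longrightarrow> f x < f z"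
  shows "the_minimizer_on A f x"
proof -
  have "\<not> f z < f x" if "z \<in> A" for z
    using assms(2)[OF that] by (cases "z = x") auto
  then show ?thesis
    using assms unfolding the_minimizer_on_def is_arg_min_def by blast
qed

lemma AM_diff_add: "AM (u - v) (u + v) = u"
  by (simp add: AM_def)

text \<open>The bounds on \<open>v\<close> make the product under the root nonnegative, so squaring
  undoes \<open>sqrt\<close>.\<close>

lemma GM_diff_add_squared: "0 \<le> v \<Longrightarrow> v \<le> u \<Longrightarrow> (GM (u - v) (u + v))\<^sup>2 = u\<^sup>2 - v\<^sup>2"
  by (simp add: GM_def power2_eq_square algebra_simps mult_mono)

lemma QM_diff_add_squared: "(QM (u - v) (u + v))\<^sup>2 = u\<^sup>2 + v\<^sup>2"
  by (simp add: QM_def power2_sum power2_diff)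

theorem mainTheorem2:
  fixes s y :: "real ^ 'n"
  assumes "CARD('n) \<ge> 2"
    and "s \<bullet> y > 0"
  shows "(\<forall>t>0. sigma_minus s y t > 0 \<and> sigma_plus s y t > 0) \<and>
    (let tstar = (s \<bullet> y) / norm s ^ 2;
         gm = (\<lambda>t. GM (sigma_minus s y t) (sigma_plus s y t));
         am = (\<lambda>t. AM (sigma_minus s y t) (sigma_plus s y t));
         qm = (\<lambda>t. QM (sigma_minus s y t) (sigma_plus s y t))
     in the_minimizer_on {0<..} (\<lambda>t. sigma_plus s y t - sigma_minus s y t) tstar \<and>
        the_minimizer_on {0<..} (\<lambda>t. (am t)^2 - (gm t)^2) tstar \<and>
        the_minimizer_on {0<..} (\<lambda>t. (qm t)^2 - (am t)^2) tstar \<and>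
        the_minimizer_on {0<..} (\<lambda>t. (qm t)^2 - (gm t)^2) tstar)"
proof -
  define p where "p = s \<bullet> y"
  define a where "a = (norm s)\<^sup>2"
  define b where "b = (norm y)\<^sup>2"
  define P where "P t = (t\<^sup>2 * a\<^sup>2 + 2 * t * p * a + a * b) / (4 * p\<^sup>2)" for t
  define M where "M t = (t\<^sup>2 * a\<^sup>2 - 2 * t * p * a + a * b) / (4 * p\<^sup>2)" for t
  define u where "u t = sqrt (P t)" for t
  define v where "v t = sqrt (M t)" for t
  have p: "p > 0" using assms(2) by (simp add: p_def)
  \<comment> \<open>\<open>s = 0\<close> would force \<open>s \<bullet> y = 0\<close>.\<close>
  have a: "a > 0" using assms(2) by (auto simp: a_def)
  have cauchy_schwarz: "p\<^sup>2 \<le> a * b"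
    unfolding p_def a_def b_def
    using Cauchy_Schwarz_ineq[of s y] by (simp add: power2_norm_eq_inner)
  \<comment> \<open>Unfolding \<open>a\<^sup>2\<close> gives a nested power of
    \<open>norm s\<close>; the flipped \<open>power_mult\<close> merges it into
    \<open>norm s ^ 4\<close>.\<close>
  have sigma_plus: "sigma_plus s y = (\<lambda>t. u t + v t)"
    and sigma_minus: "sigma_minus s y = (\<lambda>t. u t - v t)"
    by (auto simp: sigma_plus_def sigma_minus_def u_def v_def P_def M_def p_def a_def b_def
        simp flip: power_mult)
  have M_square: "M t = ((t * a - p)\<^sup>2 + (a * b - p\<^sup>2)) / (4 * p\<^sup>2)" for t
    by (simp add: M_def power2_eq_square algebra_simps)
  have M_nonneg: "M t \<ge> 0" for t
    using cauchy_schwarz by (simp add: M_square)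
  have v_nonneg: "v t \<ge> 0" for t
    by (simp add: v_def M_nonneg)
  have v_less_u: "v t < u t" if "t > 0" for t
  proof -
    \<comment> \<open>The numerators differ by \<open>4 * t * p * a\<close>, which is
      positive.\<close>
    have "M t < P t"
      unfolding M_def P_def using that p a by (intro divide_strict_right_mono) simp_all
    then show ?thesis by (simp add: u_def v_def)
  qed
  have v_min: "v (p / a) < v t" if "t \<noteq> p / a" for t
  proof -
    have "t * a - p \<noteq> 0" using that a by (simp add: field_simps)
    then have "(t * a - p)\<^sup>2 > 0" by simp
    \<comment> \<open>At \<open>p / a\<close> the square in \<open>M_square\<close> vanishes; the
      remainder \<open>a * b - p\<^sup>2\<close> does not depend on \<open>t\<close>.\<close>
    then have "M (p / a) < M t"
      using a p by (simp add: M_square divide_strict_right_mono)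
    then show ?thesis by (simp add: v_def)
  qed
  have v2_min: "(v (p / a))\<^sup>2 < (v t)\<^sup>2" if "t \<noteq> p / a" for t
    using v_min[OF that] v_nonneg by (simp add: power_strict_mono)
  have tstar: "p / a > 0" using p a by simp
  have GM: "(GM (u t - v t) (u t + v t))\<^sup>2 = (u t)\<^sup>2 - (v t)\<^sup>2" if "t > 0" for t
    using GM_diff_add_squared v_nonneg v_less_u[OF that] by simp
  have "sigma_minus s y t > 0 \<and> sigma_plus s y t > 0" if "t > 0" for t
    using v_less_u[OF that] v_nonneg[of t] by (simp add: sigma_plus sigma_minus)
  moreover have "the_minimizer_on {0<..} (\<lambda>t. u t + v t - (u t - v t)) (p / a)"
    using tstar v_min by (intro the_minimizer_onI) auto
  moreover have "the_minimizer_on {0<..}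
      (\<lambda>t. (AM (u t - v t) (u t + v t))\<^sup>2 - (GM (u t - v t) (u t + v t))\<^sup>2) (p / a)"
    using tstar v2_min by (intro the_minimizer_onI) (auto simp: AM_diff_add GM)
  moreover have "the_minimizer_on {0<..}
      (\<lambda>t. (QM (u t - v t) (u t + v t))\<^sup>2 - (AM (u t - v t) (u t + v t))\<^sup>2) (p / a)"
    using tstar v2_min by (intro the_minimizer_onI) (auto simp: AM_diff_add QM_diff_add_squared)
  moreover have "the_minimizer_on {0<..}
      (\<lambda>t. (QM (u t - v t) (u t + v t))\<^sup>2 - (GM (u t - v t) (u t + v t))\<^sup>2) (p / a)"
    using tstar v2_min by (intro the_minimizer_onI) (auto simp: QM_diff_add_squared GM)
  ultimately show ?thesis
    unfolding Let_def sigma_plus sigma_minus p_def a_def by blast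
qed

end
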